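(* Let $S$ be a semigroup. Then $S$ is a left I-order in some primitive inverse semigroup $Q$ if and only if $S$ has a zero element $0$ and satisfies all of the following conditions: (A) $S$ is categorical at $0$; (B) $S$ is $0$-cancellative; (C) the relation $\lambda$ on $S$ is transitive; (D) $Sa\neq \{0\}$ for all $a\in S$ with $a\neq 0$.
   Context: A semigroup $S$ with zero $0$ is categorical at $0$ if, for all $a,b,c\in S$, $ab\neq 0$ and $bc\neq 0$ imply $abc\neq 0$. It is $0$-cancellative if, for all $a,b,c\in S$, $ab=ac\neq 0$ implies $b=c$, and $ba=ca\neq 0$ implies $b=c$. The relation $\lambda$ on $S$ is defined by: $a\,\lambda\,b$ if and only if $a=b=0$ or $Sa\cap Sb\neq\{0\}$ (i.e. $xa=yb\neq 0$ for some $x,y\in S$). An inverse semigroup $Q$ with zero is primitive if every nonzero idempotent $e$ of $Q$ is primitive, i.e. for every idempotent $f$, $f\le e$ (that is, $ef=fe=f$) implies $f=0$ or $f=e$. A subsemigroup $S$ of an inverse semigroup $Q$ is a left I-order in $Q$ if every $q\in Q$ can be written as $q=a^{-1}b$ with $a,b\in S$, where $a^{-1}$ is the inverse of $a$ in the inverse semigroup $Q$. An abstract semigroup $S$ is said to be a left I-order in $Q$ if it embeds in $Q$ as such a subsemigroup. *)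

theory Defs
  imports "HOL-Algebra.Congruence" "HOL-Library.FuncSet"
begin

record 'a sgrp = "'a partial_object" +
  mul :: "'a \<Rightarrow> 'a \<Rightarrow> 'a"  (infixl \<open>\<cdot>\<index>\<close> 70)

locale semigrp =
  fixes S :: "('a, 'm) sgrp_scheme" (structure)
  assumes closed: "\<lbrakk>a \<in> carrier S; b \<in> carrier S\<rbrakk> \<Longrightarrow> a \<cdot> b \<in> carrier S"
    and assoc: "\<lbrakk>a \<in> carrier S; b \<in> carrier S; c \<in> carrier S\<rbrakk>
      \<Longrightarrow> (a \<cdot> b) \<cdot> c = a \<cdot> (b \<cdot> c)"

definition is_zero :: "('a, 'm) sgrp_scheme \<Rightarrow> 'a \<Rightarrow> bool" where
  "is_zero S z \<longleftrightarrow>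
     z \<in> carrier S \<and> (\<forall>a\<in>carrier S. z \<cdot>\<^bsub>S\<^esub> a = z \<and> a \<cdot>\<^bsub>S\<^esub> z = z)"

text \<open>In the next definitions \<open>z\<close> stands for the zero element of \<open>S\<close>.\<close>

definition categorical_at_zero :: "('a, 'm) sgrp_scheme \<Rightarrow> 'a \<Rightarrow> bool" where
  "categorical_at_zero S z \<longleftrightarrow>
     (\<forall>a\<in>carrier S. \<forall>b\<in>carrier S. \<forall>c\<in>carrier S.
        a \<cdot>\<^bsub>S\<^esub> b \<noteq> z \<and> b \<cdot>\<^bsub>S\<^esub> c \<noteq> z \<longrightarrow> a \<cdot>\<^bsub>S\<^esub> b \<cdot>\<^bsub>S\<^esub> c \<noteq> z)"

definition zero_cancellative :: "('a, 'm) sgrp_scheme \<Rightarrow> 'a \<Rightarrow> bool" where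
  "zero_cancellative S z \<longleftrightarrow>
     (\<forall>a\<in>carrier S. \<forall>b\<in>carrier S. \<forall>c\<in>carrier S.
        (a \<cdot>\<^bsub>S\<^esub> b = a \<cdot>\<^bsub>S\<^esub> c \<and> a \<cdot>\<^bsub>S\<^esub> c \<noteq> z \<longrightarrow> b = c) \<and>
        (b \<cdot>\<^bsub>S\<^esub> a = c \<cdot>\<^bsub>S\<^esub> a \<and> c \<cdot>\<^bsub>S\<^esub> a \<noteq> z \<longrightarrow> b = c))"

text \<open>The set \<open>Sa\<close>, with multipliers from \<open>S\<close> itself: no identity is adjoined,
  so \<open>a\<close> need not belong to it.\<close>

definition left_multiples :: "('a, 'm) sgrp_scheme \<Rightarrow> 'a \<Rightarrow> 'a set" where
  "left_multiples S a = (\<lambda>x. x \<cdot>\<^bsub>S\<^esub> a) ` carrier S"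

definition lambda_rel :: "('a, 'm) sgrp_scheme \<Rightarrow> 'a \<Rightarrow> 'a \<Rightarrow> 'a \<Rightarrow> bool" where
  "lambda_rel S z a b \<longleftrightarrow>
     (a = z \<and> b = z) \<or> left_multiples S a \<inter> left_multiples S b \<noteq> {z}"

definition is_inverse_of :: "('a, 'm) sgrp_scheme \<Rightarrow> 'a \<Rightarrow> 'a \<Rightarrow> bool" where
  "is_inverse_of Q a b \<longleftrightarrow>
     b \<in> carrier Q \<and> a \<cdot>\<^bsub>Q\<^esub> b \<cdot>\<^bsub>Q\<^esub> a = a \<and> b \<cdot>\<^bsub>Q\<^esub> a \<cdot>\<^bsub>Q\<^esub> b = b"

locale inverse_semigrp = semigrp Q for Q :: "('a, 'm) sgrp_scheme" (structure) +
  assumes ex1_inverse: "a \<in> carrier Q \<Longrightarrow> \<exists>!b. is_inverse_of Q a b"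

definition inverse_in :: "('a, 'm) sgrp_scheme \<Rightarrow> 'a \<Rightarrow> 'a" where
  "inverse_in Q a = (THE b. is_inverse_of Q a b)"

definition idempotents :: "('a, 'm) sgrp_scheme \<Rightarrow> 'a set" where
  "idempotents Q = {e \<in> carrier Q. e \<cdot>\<^bsub>Q\<^esub> e = e}"

definition primitive_inverse_semigrp :: "('a, 'm) sgrp_scheme \<Rightarrow> bool" where
  "primitive_inverse_semigrp Q \<longleftrightarrow>
     inverse_semigrp Q \<and>
     (\<exists>z. is_zero Q z \<and>
        (\<forall>e\<in>idempotents Q. e \<noteq> z \<longrightarrow>
           (\<forall>f\<in>idempotents Q. e \<cdot>\<^bsub>Q\<^esub> f = f \<and> f \<cdot>\<^bsub>Q\<^esub> e = f \<longrightarrow> f = z \<or> f = e)))"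

text \<open>\<open>left_I_order T Q\<close>: the subset \<open>T\<close> is a left I-order in the inverse semigroup \<open>Q\<close>.\<close>

definition left_I_order :: "'a set \<Rightarrow> ('a, 'm) sgrp_scheme \<Rightarrow> bool" where
  "left_I_order T Q \<longleftrightarrow>
     T \<subseteq> carrier Q \<and>
     (\<forall>a\<in>T. \<forall>b\<in>T. a \<cdot>\<^bsub>Q\<^esub> b \<in> T) \<and>
     (\<forall>q\<in>carrier Q. \<exists>a\<in>T. \<exists>b\<in>T. q = inverse_in Q a \<cdot>\<^bsub>Q\<^esub> b)"

definition semigrp_embedding ::
  "('a \<Rightarrow> 'b) \<Rightarrow> ('a, 'm) sgrp_scheme \<Rightarrow> ('b, 'n) sgrp_scheme \<Rightarrow> bool" where
  "semigrp_embedding \<phi> S Q \<longleftrightarrow>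
     \<phi> \<in> carrier S \<rightarrow> carrier Q \<and> inj_on \<phi> (carrier S) \<and>
     (\<forall>a\<in>carrier S. \<forall>b\<in>carrier S. \<phi> (a \<cdot>\<^bsub>S\<^esub> b) = \<phi> a \<cdot>\<^bsub>Q\<^esub> \<phi> b)"

definition is_left_I_order_in ::
  "('a, 'm) sgrp_scheme \<Rightarrow> ('b, 'n) sgrp_scheme \<Rightarrow> bool" where
  "is_left_I_order_in S Q \<longleftrightarrow>
     (\<exists>\<phi>. semigrp_embedding \<phi> S Q \<and> left_I_order (\<phi> ` carrier S) Q)"

definition conditions_A_to_D :: "('a, 'm) sgrp_scheme \<Rightarrow> bool" where
  "conditions_A_to_D S \<longleftrightarrow>
     (\<exists>z. is_zero S z \<and>
        categorical_at_zero S z \<and>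
        zero_cancellative S z \<and>
        transp_on (carrier S) (lambda_rel S z) \<and>
        (\<forall>a\<in>carrier S. a \<noteq> z \<longrightarrow> left_multiples S a \<noteq> {z}))"

text \<open>
  HOL cannot quantify existentially over the type containing the elements of \<open>Q\<close>.
  A \<open>Q\<close> in which \<open>S\<close> is a left I-order is the image of \<open>S \<times> S\<close> under
  \<open>(a, b) \<mapsto> a\<inverse>b\<close>, so it has an isomorphic copy whose carrier is a set of subsets of
  \<open>S \<times> S\<close> (the fibres of that map). Hence ``some \<open>Q\<close>'' can be read as ``some \<open>Q\<close> with
  elements of type \<^typ>\<open>('a \<times> 'a) set\<close>'' without loss of generality. To keep the
  implication from left to right independent of this remark, the theorem also asserts it
  for \<open>Q\<close> over an arbitrary type \<open>'b\<close>.
\<close>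

end

theory Submission
  imports Defs
begin

text \<open>
  In a primitive inverse semigroup \<open>ab \<noteq> 0\<close> forces \<open>a\<inverse>a = bb\<inverse>\<close>, from which all the
  conditions on \<open>S\<close> follow by direct calculation. Conversely, let \<open>S\<close> satisfy the conditions.
  A nonzero fraction \<open>q\<close> is represented by the set of all pairs \<open>(a, b)\<close> with \<open>a\<inverse>b = q\<close>, seen as
  a binary relation on \<open>S\<close>. These fibres are characterised intrinsically: they are closed under
  passing between \<open>(a, b)\<close> and \<open>(va, vb)\<close>, and any two members have a common multiple of this
  kind. The inverse is the converse relation, and the product is the saturation, under removal of
  common left factors, of the relational composition; the zero is the empty relation.
  Saturation is needed because, when \<open>qr = a\<inverse>c\<close>, no \<open>b\<close> in \<open>S\<close> need satisfy both \<open>q = a\<inverse>b\<close> and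
  \<open>r = b\<inverse>c\<close>.
  An element \<open>a\<close> of \<open>S\<close> corresponds to its right translation \<open>x \<mapsto> xa \<noteq> 0\<close>.
\<close>

section \<open>Primitive inverse semigroups\<close>

context semigrp
begin

text \<open>Where inverses are unique, the two claims together force
  \<open>x = f \<cdot> x \<cdot> e\<close>, so the inverse of a product of idempotents is itself
  idempotent.\<close>

lemma inverse_of_idempotent_product:
  assumes e: "e \<in> idempotents S" and f: "f \<in> idempotents S"
    and x: "is_inverse_of S (e \<cdot> f) x"
  shows "is_inverse_of S (e \<cdot> f) (f \<cdot> x \<cdot> e)" and "(f \<cdot> x \<cdot> e) \<cdot> (f \<cdot> x \<cdot> e) = f \<cdot> x \<cdot> e"
proof -
  have c: "e \<in> carrier S" "f \<in> carrier S" "x \<in> carrier S" and i: "e \<cdot> e = e" "f \<cdot> f = f"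
    and x1: "e \<cdot> f \<cdot> x \<cdot> (e \<cdot> f) = e \<cdot> f" and x2: "x \<cdot> (e \<cdot> f) \<cdot> x = x"
    using e f x by (auto simp: idempotents_def is_inverse_of_def)
  have l: "e \<cdot> (e \<cdot> y) = e \<cdot> y" "f \<cdot> (f \<cdot> y) = f \<cdot> y" if "y \<in> carrier S" for y
    using assoc[of e e y] assoc[of f f y] that c i by auto
  have x2': "x \<cdot> (e \<cdot> (f \<cdot> (x \<cdot> y))) = x \<cdot> y" if "y \<in> carrier S" for y
    using arg_cong[OF x2, of "\<lambda>t. t \<cdot> y"] that c by (simp add: assoc closed)
  show "(f \<cdot> x \<cdot> e) \<cdot> (f \<cdot> x \<cdot> e) = f \<cdot> x \<cdot> e"
    using c by (simp add: assoc closed x2')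
  show "is_inverse_of S (e \<cdot> f) (f \<cdot> x \<cdot> e)"
    unfolding is_inverse_of_def using c x1 by (simp add: assoc closed l x2')
qed

end

context inverse_semigrp
begin

abbreviation iv :: "'a \<Rightarrow> 'a" where "iv \<equiv> inverse_in Q"

lemma is_inverse_iv: "a \<in> carrier Q \<Longrightarrow> is_inverse_of Q a (iv a)"
  unfolding inverse_in_def using ex1_inverse by (rule theI')

lemma inverse_unique:
  "\<lbrakk>a \<in> carrier Q; is_inverse_of Q a b; is_inverse_of Q a c\<rbrakk> \<Longrightarrow> b = c"
  using ex1_inverse by blast

lemma iv_closed [simp]: "a \<in> carrier Q \<Longrightarrow> iv a \<in> carrier Q"
  and iv_left: "a \<in> carrier Q \<Longrightarrow> a \<cdot> iv a \<cdot> a = a"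
  and iv_right: "a \<in> carrier Q \<Longrightarrow> iv a \<cdot> a \<cdot> iv a = iv a"
  using is_inverse_iv by (auto simp: is_inverse_of_def)

lemma iv_iv [simp]: "a \<in> carrier Q \<Longrightarrow> iv (iv a) = a"
  by (rule inverse_unique[of "iv a"])
    (use is_inverse_iv[of "iv a"] in \<open>auto simp: is_inverse_of_def iv_left iv_right\<close>)

lemma iv_idempotents:
  assumes "a \<in> carrier Q"
  shows "iv a \<cdot> a \<in> idempotents Q" "a \<cdot> iv a \<in> idempotents Q"
  using assms iv_left[OF assms] iv_right[OF assms]
  by (auto simp: idempotents_def closed) (metis assoc closed iv_closed)+

text \<open>The inverse \<open>?x\<close> of ef is idempotent, hence its own inverse; but ef is also
  an inverse of \<open>?x\<close>, so the two coincide.\<close>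

lemma idempotents_mult:
  assumes e: "e \<in> idempotents Q" and f: "f \<in> idempotents Q"
  shows "e \<cdot> f \<in> idempotents Q"
proof -
  have c: "e \<in> carrier Q" "f \<in> carrier Q" using e f by (auto simp: idempotents_def)
  then have ef: "e \<cdot> f \<in> carrier Q" by (rule closed)
  let ?x = "iv (e \<cdot> f)"
  have inv: "is_inverse_of Q (e \<cdot> f) ?x" by (rule is_inverse_iv[OF ef])
  have "f \<cdot> ?x \<cdot> e = ?x"
    by (rule inverse_unique[OF ef inverse_of_idempotent_product(1)[OF e f inv] inv])
  with inverse_of_idempotent_product(2)[OF e f inv] have idem: "?x \<cdot> ?x = ?x" by simp
  have x: "?x \<in> carrier Q" using ef by simp
  have "is_inverse_of Q ?x ?x" "is_inverse_of Q ?x (e \<cdot> f)"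
    using x ef iv_left[OF ef] iv_right[OF ef] by (auto simp: is_inverse_of_def idem)
  from inverse_unique[OF x this] idem ef show ?thesis by (simp add: idempotents_def)
qed

text \<open>Since ef and fe are idempotent, each of them is an inverse of ef.\<close>

lemma idempotents_commute:
  assumes e: "e \<in> idempotents Q" and f: "f \<in> idempotents Q"
  shows "e \<cdot> f = f \<cdot> e"
proof -
  have c: "e \<in> carrier Q" "f \<in> carrier Q" and i: "e \<cdot> e = e" "f \<cdot> f = f"
    using e f by (auto simp: idempotents_def)
  have l: "e \<cdot> (e \<cdot> y) = e \<cdot> y" "f \<cdot> (f \<cdot> y) = f \<cdot> y" if "y \<in> carrier Q" for y
    using assoc[of e e y] assoc[of f f y] that c i by auto
  have ef: "e \<cdot> f \<cdot> (e \<cdot> f) = e \<cdot> f" "f \<cdot> e \<cdot> (f \<cdot> e) = f \<cdot> e"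
    using idempotents_mult[OF e f] idempotents_mult[OF f e] by (auto simp: idempotents_def)
  have "is_inverse_of Q (e \<cdot> f) (e \<cdot> f)"
    using c by (simp add: is_inverse_of_def closed ef)
  moreover have "is_inverse_of Q (e \<cdot> f) (f \<cdot> e)"
    using c ef by (simp add: is_inverse_of_def closed assoc l)
  ultimately show ?thesis using c by (blast intro: inverse_unique closed)
qed

end

locale primitive_inverse = inverse_semigrp +
  fixes z
  assumes zero: "is_zero Q z"
    and primitive: "\<lbrakk>e \<in> idempotents Q; e \<noteq> z; f \<in> idempotents Q; e \<cdot> f = f; f \<cdot> e = f\<rbrakk>
      \<Longrightarrow> f = z \<or> f = e"
begin

lemma zero_closed [simp]: "z \<in> carrier Q"
  and zero_mult [simp]: "a \<in> carrier Q \<Longrightarrow> z \<cdot> a = z" "a \<in> carrier Q \<Longrightarrow> a \<cdot> z = z"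
  using zero by (auto simp: is_zero_def)

text \<open>Idempotents commute, so ef lies below both e and f; being nonzero, it equals each of
  them by primitivity.\<close>

lemma idempotents_eq:
  assumes e: "e \<in> idempotents Q" and f: "f \<in> idempotents Q" and ne: "e \<cdot> f \<noteq> z"
  shows "e = f"
proof -
  have below: "e \<cdot> f = e" if "e \<in> idempotents Q" "f \<in> idempotents Q" "e \<cdot> f \<noteq> z" for e f
  proof -
    have c: "e \<in> carrier Q" "f \<in> carrier Q" and i: "e \<cdot> e = e"
      using that by (auto simp: idempotents_def)
    have "e \<cdot> (e \<cdot> f) = e \<cdot> f" using c i assoc[of e e f] by simp
    moreover have "e \<cdot> f \<cdot> e = e \<cdot> f"
      using c i assoc[of f e e] idempotents_commute[OF that(1,2)] by simp
    moreover have "e \<noteq> z" using that c by auto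
    ultimately show ?thesis using primitive[OF that(1) _ idempotents_mult[OF that(1,2)]] that by blast
  qed
  show ?thesis
    using below[OF e f ne] below[OF f e] ne idempotents_commute[OF e f] by metis
qed

text \<open>Inserting a = aa\<inverse>a and b = bb\<inverse>b into ab shows that the product of the
  two idempotents cannot vanish, so \<open>idempotents_eq\<close> applies.\<close>

lemma mult_nonzero_iv:
  assumes a: "a \<in> carrier Q" and b: "b \<in> carrier Q" and ne: "a \<cdot> b \<noteq> z"
  shows "iv a \<cdot> a = b \<cdot> iv b"
proof (rule idempotents_eq)
  show "iv a \<cdot> a \<cdot> (b \<cdot> iv b) \<noteq> z"
  proof
    assume eq: "iv a \<cdot> a \<cdot> (b \<cdot> iv b) = z"
    have "a \<cdot> b = a \<cdot> iv a \<cdot> a \<cdot> (b \<cdot> iv b \<cdot> b)" using iv_left a b by simp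
    also have "\<dots> = a \<cdot> (iv a \<cdot> a \<cdot> (b \<cdot> iv b)) \<cdot> b" using a b by (simp add: assoc closed)
    finally show False using eq ne a b by simp
  qed
qed (use iv_idempotents a b in auto)

lemma iv_cancel_left:
  assumes a: "a \<in> carrier Q" and b: "b \<in> carrier Q" and ne: "a \<cdot> b \<noteq> z"
  shows "iv a \<cdot> (a \<cdot> b) = b"
  using mult_nonzero_iv[OF assms] iv_left[OF b] a b assoc[of "iv a" a b] by simp

lemma iv_cancel_right:
  assumes a: "a \<in> carrier Q" and b: "b \<in> carrier Q" and ne: "a \<cdot> b \<noteq> z"
  shows "a \<cdot> b \<cdot> iv b = a"
  using mult_nonzero_iv[OF assms] iv_left[OF a] a b by (simp add: assoc)

end

lemma primitive_inverse_semigrp_iff: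
  "primitive_inverse_semigrp Q \<longleftrightarrow> (\<exists>z. primitive_inverse Q z)"
  unfolding primitive_inverse_semigrp_def primitive_inverse_def primitive_inverse_axioms_def
  by blast

text \<open>The zero lies in both sets of left multiples, so their intersection is never empty and
  differs from \<open>{z}\<close> exactly when it has a nonzero member.\<close>

lemma lambda_rel_iff:
  assumes "is_zero S z" "a \<in> carrier S" "b \<in> carrier S"
  shows "lambda_rel S z a b \<longleftrightarrow> (a = z \<and> b = z) \<or>
    (\<exists>x\<in>carrier S. \<exists>y\<in>carrier S. x \<cdot>\<^bsub>S\<^esub> a = y \<cdot>\<^bsub>S\<^esub> b \<and> y \<cdot>\<^bsub>S\<^esub> b \<noteq> z)"
proof -
  have "z \<in> left_multiples S a \<inter> left_multiples S b"
    using assms unfolding left_multiples_def is_zero_def by (auto intro!: image_eqI[of _ _ z])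
  then have "left_multiples S a \<inter> left_multiples S b \<noteq> {z} \<longleftrightarrow>
      (\<exists>t. t \<in> left_multiples S a \<inter> left_multiples S b \<and> t \<noteq> z)" by blast
  then show ?thesis by (auto simp: lambda_rel_def left_multiples_def)
qed

lemma left_multiples_nonzero_iff:
  assumes "is_zero S z" "a \<in> carrier S"
  shows "left_multiples S a \<noteq> {z} \<longleftrightarrow> (\<exists>x\<in>carrier S. x \<cdot>\<^bsub>S\<^esub> a \<noteq> z)"
proof -
  have "z \<in> left_multiples S a"
    using assms unfolding left_multiples_def is_zero_def by (auto intro!: image_eqI[of _ _ z])
  then show ?thesis by (auto simp: left_multiples_def)
qed

section \<open>Necessity of the conditions\<close>

text \<open>Write 0 = a\<inverse>b. If aa and ab are both nonzero, then b = a\<inverse>ab =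
  aa\<inverse>b = 0. Otherwise one of these two products, which belong to \<open>T\<close>, is
  zero.\<close>

lemma (in primitive_inverse) zero_in_left_I_order:
  assumes T: "left_I_order T Q"
  shows "z \<in> T"
proof -
  obtain a b where ab: "a \<in> T" "b \<in> T" and eq: "z = iv a \<cdot> b"
    using T by (auto simp: left_I_order_def) (use zero_closed in blast)
  have c: "a \<in> carrier Q" "b \<in> carrier Q" and T': "a \<cdot> a \<in> T" "a \<cdot> b \<in> T"
    using T ab by (auto simp: left_I_order_def)
  show ?thesis
  proof (cases "a \<cdot> a = z \<or> a \<cdot> b = z")
    case True
    then show ?thesis using T' by auto
  next
    case False
    have "b = iv a \<cdot> a \<cdot> b" using iv_cancel_left[of a b] False c by (simp add: assoc)
    also have "\<dots> = a \<cdot> (iv a \<cdot> b)" using mult_nonzero_iv[of a a] False c by (simp add: assoc)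
    also have "\<dots> = z" using c by (simp flip: eq)
    finally show ?thesis using ab by simp
  qed
qed

lemma (in primitive_inverse) left_I_order_conditions:
  assumes S: "semigrp S" and I: "is_left_I_order_in S Q"
  shows "conditions_A_to_D S"
proof -
  interpret S: semigrp S by (rule S)
  obtain \<phi> where emb: "semigrp_embedding \<phi> S Q" and T: "left_I_order (\<phi> ` carrier S) Q"
    using I by (auto simp: is_left_I_order_in_def)
  have \<phi>c [simp]: "\<phi> a \<in> carrier Q" if "a \<in> carrier S" for a
    using emb that by (auto simp: semigrp_embedding_def)
  have \<phi>m [simp]: "\<phi> (a \<cdot>\<^bsub>S\<^esub> b) = \<phi> a \<cdot> \<phi> b" if "a \<in> carrier S" "b \<in> carrier S" for a b
    using emb that by (auto simp: semigrp_embedding_def)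
  have inj: "\<phi> a = \<phi> b \<longleftrightarrow> a = b" if "a \<in> carrier S" "b \<in> carrier S" for a b
    using emb that by (auto simp: semigrp_embedding_def inj_on_def)
  have frac: "\<exists>a\<in>carrier S. \<exists>b\<in>carrier S. q = iv (\<phi> a) \<cdot> \<phi> b" if "q \<in> carrier Q" for q
    using T that by (auto simp: left_I_order_def)
  \<comment> \<open>The zero of \<open>S\<close> is obtained as the preimage of the zero of
    \<open>Q\<close>.\<close>
  obtain w where w: "w \<in> carrier S" and \<phi>w: "\<phi> w = z"
    using zero_in_left_I_order[OF T] by auto
  have w_iff: "a = w \<longleftrightarrow> \<phi> a = z" if "a \<in> carrier S" for a
    using inj[OF that w] \<phi>w by auto
  note [simp] = S.closed w \<phi>w
  have wz: "is_zero S w"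
    using w by (auto simp: is_zero_def w_iff)
  \<comment> \<open>Categoricity holds in all of \<open>Q\<close>: from ab \<noteq> 0 follows bc =
    a\<inverse>(abc), which would vanish together with abc.\<close>
  have A: "a \<cdot> b \<cdot> c \<noteq> z"
    if "a \<in> carrier Q" "b \<in> carrier Q" "c \<in> carrier Q" "a \<cdot> b \<noteq> z" "b \<cdot> c \<noteq> z" for a b c
  proof
    assume "a \<cdot> b \<cdot> c = z"
    moreover have "b \<cdot> c = iv a \<cdot> (a \<cdot> b \<cdot> c)"
      using iv_cancel_left[of a b] assoc[of "iv a" "a \<cdot> b" c] that by (simp add: closed)
    ultimately show False using that by simp
  qed
  have "categorical_at_zero S w"
    using A by (auto simp: categorical_at_zero_def w_iff)
  moreover have "zero_cancellative S w"
    unfolding zero_cancellative_def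
  proof (intro ballI conjI impI; elim conjE)
    fix a b c assume c: "a \<in> carrier S" "b \<in> carrier S" "c \<in> carrier S"
    show "b = c" if "a \<cdot>\<^bsub>S\<^esub> b = a \<cdot>\<^bsub>S\<^esub> c" "a \<cdot>\<^bsub>S\<^esub> c \<noteq> w"
    proof -
      have "\<phi> a \<cdot> \<phi> b = \<phi> a \<cdot> \<phi> c" "\<phi> a \<cdot> \<phi> c \<noteq> z"
        using that c by (auto simp: w_iff simp flip: \<phi>m)
      then have "\<phi> b = \<phi> c" using c by (metis iv_cancel_left \<phi>c)
      then show ?thesis using inj c by simp
    qed
    show "b = c" if "b \<cdot>\<^bsub>S\<^esub> a = c \<cdot>\<^bsub>S\<^esub> a" "c \<cdot>\<^bsub>S\<^esub> a \<noteq> w"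
    proof -
      have "\<phi> b \<cdot> \<phi> a = \<phi> c \<cdot> \<phi> a" "\<phi> c \<cdot> \<phi> a \<noteq> z"
        using that c by (auto simp: w_iff simp flip: \<phi>m)
      then have "\<phi> b = \<phi> c" using c by (metis iv_cancel_right \<phi>c)
      then show ?thesis using inj c by simp
    qed
  qed
  moreover have "transp_on (carrier S) (lambda_rel S w)"
  proof (rule transp_onI)
    fix a b c assume c: "a \<in> carrier S" "b \<in> carrier S" "c \<in> carrier S"
      and ab: "lambda_rel S w a b" and bc: "lambda_rel S w b c"
    show "lambda_rel S w a c"
    \<comment> \<open>Only the zero is \<lambda>-related to the zero, which settles the first
      case.\<close>
    proof (cases "b = w")
      case True
      then show ?thesis using ab bc c wz by (auto simp: lambda_rel_iff is_zero_def)
    next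
      case False
      obtain x y where xy: "x \<in> carrier S" "y \<in> carrier S"
        and "x \<cdot>\<^bsub>S\<^esub> a = y \<cdot>\<^bsub>S\<^esub> b" "y \<cdot>\<^bsub>S\<^esub> b \<noteq> w"
        using ab False lambda_rel_iff[OF wz c(1,2)] by blast
      then have xa: "\<phi> x \<cdot> \<phi> a = \<phi> y \<cdot> \<phi> b" and yb: "\<phi> y \<cdot> \<phi> b \<noteq> z"
        using c by (auto simp: w_iff simp flip: \<phi>m)
      obtain u v where uv: "u \<in> carrier S" "v \<in> carrier S"
        and "u \<cdot>\<^bsub>S\<^esub> b = v \<cdot>\<^bsub>S\<^esub> c" "v \<cdot>\<^bsub>S\<^esub> c \<noteq> w"
        using bc False lambda_rel_iff[OF wz c(2,3)] by blast
      then have ub: "\<phi> u \<cdot> \<phi> b = \<phi> v \<cdot> \<phi> c" "\<phi> u \<cdot> \<phi> b \<noteq> z"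
        using c by (auto simp: w_iff simp flip: \<phi>m)
      \<comment> \<open>The multipliers joining the two chains come from writing yu\<inverse> as a
        left fraction s\<inverse>t: then sy = tu, and hence sxa = syb = tub = tvc.\<close>
      obtain s t where st: "s \<in> carrier S" "t \<in> carrier S"
        and q: "\<phi> y \<cdot> iv (\<phi> u) = iv (\<phi> s) \<cdot> \<phi> t"
        using frac[of "\<phi> y \<cdot> iv (\<phi> u)"] xy uv by (auto simp: closed)
      \<comment> \<open>Both idempotents equal bb\<inverse>, because ub and yb are nonzero.\<close>
      have "iv (\<phi> u) \<cdot> \<phi> u = iv (\<phi> y) \<cdot> \<phi> y"
        using mult_nonzero_iv[of "\<phi> u" "\<phi> b"] mult_nonzero_iv[of "\<phi> y" "\<phi> b"] yb ub c xy uv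
        by simp
      then have "\<phi> y \<cdot> iv (\<phi> u) \<cdot> \<phi> u = \<phi> y"
        using iv_left[of "\<phi> y"] xy uv by (simp add: assoc)
      then have y: "\<phi> y = iv (\<phi> s) \<cdot> (\<phi> t \<cdot> \<phi> u)"
        using q st uv by (simp add: assoc)
      have y0: "\<phi> y \<noteq> z" using yb c by (metis zero_mult(1) \<phi>c)
      then have "\<phi> s \<cdot> \<phi> y = \<phi> t \<cdot> \<phi> u"
        using iv_cancel_left[of "iv (\<phi> s)" "\<phi> t \<cdot> \<phi> u"] y st uv by (simp add: closed)
      then have sy: "\<phi> s \<cdot> \<phi> y = \<phi> t \<cdot> \<phi> u" "\<phi> s \<cdot> \<phi> y \<noteq> z"
        using y y0 st by (metis iv_closed \<phi>c zero_mult(2))+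
      have "\<phi> ((s \<cdot>\<^bsub>S\<^esub> x) \<cdot>\<^bsub>S\<^esub> a) = \<phi> s \<cdot> \<phi> y \<cdot> \<phi> b"
        using st xy c xa by (simp add: assoc)
      moreover have "\<phi> ((t \<cdot>\<^bsub>S\<^esub> v) \<cdot>\<^bsub>S\<^esub> c) = \<phi> s \<cdot> \<phi> y \<cdot> \<phi> b"
        using st uv c sy(1) ub(1) by (simp add: assoc)
      moreover have "\<phi> s \<cdot> \<phi> y \<cdot> \<phi> b \<noteq> z"
        using A[of "\<phi> s" "\<phi> y" "\<phi> b"] sy(2) yb st xy c by simp
      ultimately have "(s \<cdot>\<^bsub>S\<^esub> x) \<cdot>\<^bsub>S\<^esub> a = (t \<cdot>\<^bsub>S\<^esub> v) \<cdot>\<^bsub>S\<^esub> c" "(t \<cdot>\<^bsub>S\<^esub> v) \<cdot>\<^bsub>S\<^esub> c \<noteq> w"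
        using st xy uv c inj[of "(s \<cdot>\<^bsub>S\<^esub> x) \<cdot>\<^bsub>S\<^esub> a" "(t \<cdot>\<^bsub>S\<^esub> v) \<cdot>\<^bsub>S\<^esub> c"]
          w_iff[of "(t \<cdot>\<^bsub>S\<^esub> v) \<cdot>\<^bsub>S\<^esub> c"] by (auto simp del: \<phi>m)
      then show ?thesis
        using lambda_rel_iff[OF wz c(1,3)] S.closed st xy uv by metis
    qed
  qed
  \<comment> \<open>Writing a\<inverse> = x\<inverse>y gives a = aa\<inverse>a = ax\<inverse>(ya),
    so ya cannot be zero.\<close>
  moreover have "\<exists>y\<in>carrier S. y \<cdot>\<^bsub>S\<^esub> a \<noteq> w" if a: "a \<in> carrier S" "a \<noteq> w" for a
  proof -
    obtain x y where xy: "x \<in> carrier S" "y \<in> carrier S" and q: "iv (\<phi> a) = iv (\<phi> x) \<cdot> \<phi> y"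
      using frac[of "iv (\<phi> a)"] a by auto
    have "\<phi> a = \<phi> a \<cdot> iv (\<phi> x) \<cdot> (\<phi> y \<cdot> \<phi> a)"
      using iv_left[of "\<phi> a"] q a xy by (simp add: assoc closed)
    then have "\<phi> y \<cdot> \<phi> a \<noteq> z"
      using a xy w_iff by (metis closed iv_closed \<phi>c zero_mult(2))
    then show ?thesis using a xy by (auto simp: w_iff)
  qed
  ultimately show ?thesis
    unfolding conditions_A_to_D_def using wz left_multiples_nonzero_iff[OF wz] by blast
qed

lemma conditions_if_left_I_order:
  "\<lbrakk>semigrp S; primitive_inverse_semigrp Q; is_left_I_order_in S Q\<rbrakk> \<Longrightarrow> conditions_A_to_D S"
  by (auto simp: primitive_inverse_semigrp_iff intro: primitive_inverse.left_I_order_conditions)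

section \<open>The semigroup of left fractions\<close>

locale left_fractions = semigrp +
  fixes z
  assumes zero: "is_zero S z"
    and cat: "\<lbrakk>a \<in> carrier S; b \<in> carrier S; c \<in> carrier S; a \<cdot> b \<noteq> z; b \<cdot> c \<noteq> z\<rbrakk>
      \<Longrightarrow> a \<cdot> (b \<cdot> c) \<noteq> z"
    and canc_left: "\<lbrakk>a \<in> carrier S; b \<in> carrier S; c \<in> carrier S; a \<cdot> b = a \<cdot> c; a \<cdot> c \<noteq> z\<rbrakk>
      \<Longrightarrow> b = c"
    and canc_right: "\<lbrakk>a \<in> carrier S; b \<in> carrier S; c \<in> carrier S; b \<cdot> a = c \<cdot> a; c \<cdot> a \<noteq> z\<rbrakk>
      \<Longrightarrow> b = c"
    and trans_lambda: "transp_on (carrier S) (lambda_rel S z)"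
    and left_nonzero: "\<lbrakk>a \<in> carrier S; a \<noteq> z\<rbrakk> \<Longrightarrow> \<exists>x\<in>carrier S. x \<cdot> a \<noteq> z"
begin

section \<open>Common left multiples, and the pairs that can form a nonzero fraction\<close>

lemma zero_closed [simp]: "z \<in> carrier S"
  and zero_mult [simp]: "a \<in> carrier S \<Longrightarrow> z \<cdot> a = z" "a \<in> carrier S \<Longrightarrow> a \<cdot> z = z"
  using zero by (auto simp: is_zero_def)

declare closed [simp]

text \<open>By condition (D) some uxa is nonzero; it is a left multiple of xa, and through the
  multiplier ux also of a.\<close>

lemma lambda_mult:
  assumes "x \<in> carrier S" "a \<in> carrier S" "x \<cdot> a \<noteq> z"
  shows "lambda_rel S z (x \<cdot> a) a" "lambda_rel S z a (x \<cdot> a)"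
proof -
  obtain u where u: "u \<in> carrier S" "u \<cdot> (x \<cdot> a) \<noteq> z"
    using left_nonzero[of "x \<cdot> a"] assms by auto
  then have "u \<cdot> (x \<cdot> a) = (u \<cdot> x) \<cdot> a" using assms by (simp add: assoc)
  then show "lambda_rel S z (x \<cdot> a) a" "lambda_rel S z a (x \<cdot> a)"
    using u assms by (auto simp: lambda_rel_iff[OF zero]) (metis closed)+
qed

text \<open>Both \<open>xb\<close> and \<open>yb\<close> are \<open>\<lambda>\<close>-related to \<open>b\<close>; the factor \<open>b\<close> is then cancelled.\<close>

lemma common_left_multiple:
  assumes c: "x \<in> carrier S" "y \<in> carrier S" "b \<in> carrier S"
    and ne: "x \<cdot> b \<noteq> z" "y \<cdot> b \<noteq> z"
  obtains u v where "u \<in> carrier S" "v \<in> carrier S" "u \<cdot> x = v \<cdot> y" "v \<cdot> y \<noteq> z"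
proof -
  have "lambda_rel S z (x \<cdot> b) (y \<cdot> b)"
    using transp_onD[OF trans_lambda] lambda_mult c ne closed by meson
  then obtain u v where uv: "u \<in> carrier S" "v \<in> carrier S"
    and eq: "u \<cdot> (x \<cdot> b) = v \<cdot> (y \<cdot> b)" "v \<cdot> (y \<cdot> b) \<noteq> z"
    using ne c by (auto simp: lambda_rel_iff[OF zero])
  have "u \<cdot> x = v \<cdot> y"
    using eq canc_right[of b "u \<cdot> x" "v \<cdot> y"] c uv by (simp add: assoc)
  moreover have "v \<cdot> y \<noteq> z"
    using eq(2) c uv by (metis assoc zero_mult(1))
  ultimately show thesis using that uv by blast
qed

text \<open>In the intended \<open>Q\<close> the hypotheses on b say x\<inverse>x = bb\<inverse> =
  y\<inverse>y. A nonzero common multiple ux = vy replaces this equality: vyc is nonzero by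
  categoricity, and vyc = uxc.\<close>

lemma nonzero_transfer:
  assumes c: "x \<in> carrier S" "y \<in> carrier S" "b \<in> carrier S" "c \<in> carrier S"
    and ne: "x \<cdot> b \<noteq> z" "y \<cdot> b \<noteq> z" "y \<cdot> c \<noteq> z"
  shows "x \<cdot> c \<noteq> z"
proof
  assume "x \<cdot> c = z"
  obtain u v where uv: "u \<in> carrier S" "v \<in> carrier S" "u \<cdot> x = v \<cdot> y" "v \<cdot> y \<noteq> z"
    using common_left_multiple c ne by blast
  have "v \<cdot> (y \<cdot> c) = u \<cdot> (x \<cdot> c)" using uv c by (simp flip: assoc)
  then show False using cat[of v y c] \<open>x \<cdot> c = z\<close> uv c ne by simp
qed

text \<open>The pairs \<open>(a, b)\<close> for which the fraction \<open>a\<inverse>b\<close> is going to be nonzero.\<close>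

definition pairs :: "('a \<times> 'a) set" where
  "pairs = {(a, b) \<in> carrier S \<times> carrier S. \<exists>x\<in>carrier S. x \<cdot> a \<noteq> z \<and> x \<cdot> b \<noteq> z}"

lemma pairs_closed: "(a, b) \<in> pairs \<Longrightarrow> a \<in> carrier S" "(a, b) \<in> pairs \<Longrightarrow> b \<in> carrier S"
  by (auto simp: pairs_def)

lemma pairs_sym: "(a, b) \<in> pairs \<Longrightarrow> (b, a) \<in> pairs"
  by (auto simp: pairs_def)

text \<open>By \<open>nonzero_transfer\<close> a single common multiplier, as in
  \<open>pairs\<close>, makes a and b survive under the same left factors. Transitivity of
  \<open>pairs\<close> rests on this.\<close>

lemma pairs_nonzero:
  "\<lbrakk>(a, b) \<in> pairs; v \<in> carrier S; v \<cdot> a \<noteq> z\<rbrakk> \<Longrightarrow> v \<cdot> b \<noteq> z"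
  using nonzero_transfer by (auto simp: pairs_def)

lemma pairs_nonzero_iff:
  "\<lbrakk>(a, b) \<in> pairs; v \<in> carrier S\<rbrakk> \<Longrightarrow> v \<cdot> a = z \<longleftrightarrow> v \<cdot> b = z"
  using pairs_nonzero pairs_sym by blast

lemma pairs_trans: "\<lbrakk>(a, b) \<in> pairs; (b, c) \<in> pairs\<rbrakk> \<Longrightarrow> (a, c) \<in> pairs"
  using pairs_nonzero[of b c] by (auto simp: pairs_def)

lemma pairs_mult:
  assumes "(a, b) \<in> pairs" "v \<in> carrier S" "v \<cdot> a \<noteq> z"
  shows "(v \<cdot> a, v \<cdot> b) \<in> pairs"
proof -
  have c: "a \<in> carrier S" "b \<in> carrier S" using assms(1) by (auto simp: pairs_def)
  obtain x where x: "x \<in> carrier S" "x \<cdot> (v \<cdot> a) \<noteq> z"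
    using left_nonzero[of "v \<cdot> a"] assms c by auto
  then have "x \<cdot> (v \<cdot> b) \<noteq> z"
    using pairs_nonzero[OF assms(1), of "x \<cdot> v"] assms(2) c by (simp add: assoc)
  then show ?thesis using x assms(2) c by (auto simp: pairs_def)
qed

lemma pairs_unmult:
  assumes "(u \<cdot> a, u \<cdot> b) \<in> pairs" "u \<in> carrier S" "a \<in> carrier S" "b \<in> carrier S"
  shows "(a, b) \<in> pairs"
  using assms by (auto simp: pairs_def) (metis assoc closed)

lemma pairs_fst_nonzero: "(a, b) \<in> pairs \<Longrightarrow> a \<noteq> z"
  by (auto simp: pairs_def)

section \<open>Relations representing fractions, their composition and converse\<close>

definition mult_closed :: "('a \<times> 'a) set \<Rightarrow> bool" where
  "mult_closed P \<longleftrightarrow> P \<subseteq> pairs \<and>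
     (\<forall>(a, b)\<in>P. \<forall>v\<in>carrier S. v \<cdot> a \<noteq> z \<longrightarrow> (v \<cdot> a, v \<cdot> b) \<in> P)"

definition sat :: "('a \<times> 'a) set \<Rightarrow> ('a \<times> 'a) set" where
  "sat P = {(a, b) \<in> carrier S \<times> carrier S. \<exists>u\<in>carrier S. (u \<cdot> a, u \<cdot> b) \<in> P}"

definition directed :: "('a \<times> 'a) set \<Rightarrow> bool" where
  "directed P \<longleftrightarrow> (\<forall>(a, b)\<in>P. \<forall>(c, d)\<in>P. \<exists>u\<in>carrier S. \<exists>v\<in>carrier S.
     u \<cdot> a \<noteq> z \<and> u \<cdot> a = v \<cdot> c \<and> u \<cdot> b = v \<cdot> d)"

text \<open>The empty relation qualifies and will be the zero. For \<open>sat\<close> one inclusion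
  suffices, the other being \<open>subset_sat\<close>.\<close>

definition fraction :: "('a \<times> 'a) set \<Rightarrow> bool" where
  "fraction P \<longleftrightarrow> mult_closed P \<and> sat P \<subseteq> P \<and> directed P"

lemma mult_closedD: "mult_closed P \<Longrightarrow> (a, b) \<in> P \<Longrightarrow> (a, b) \<in> pairs"
  "mult_closed P \<Longrightarrow> (a, b) \<in> P \<Longrightarrow> v \<in> carrier S \<Longrightarrow> v \<cdot> a \<noteq> z \<Longrightarrow> (v \<cdot> a, v \<cdot> b) \<in> P"
  by (auto simp: mult_closed_def)

lemma directedE:
  assumes "directed P" "(a, b) \<in> P" "(c, d) \<in> P"
  obtains u v where "u \<in> carrier S" "v \<in> carrier S"
    "u \<cdot> a \<noteq> z" "u \<cdot> a = v \<cdot> c" "u \<cdot> b = v \<cdot> d"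
  using assms unfolding directed_def by fast

lemma satE:
  assumes "(a, b) \<in> sat P"
  obtains u where "a \<in> carrier S" "b \<in> carrier S" "u \<in> carrier S" "(u \<cdot> a, u \<cdot> b) \<in> P"
  using assms by (auto simp: sat_def)

lemma satI:
  "\<lbrakk>a \<in> carrier S; b \<in> carrier S; u \<in> carrier S; (u \<cdot> a, u \<cdot> b) \<in> P\<rbrakk> \<Longrightarrow> (a, b) \<in> sat P"
  by (auto simp: sat_def)

lemma sat_mono: "P \<subseteq> R \<Longrightarrow> sat P \<subseteq> sat R"
  by (auto simp: sat_def)

lemma subset_sat:
  assumes P: "mult_closed P"
  shows "P \<subseteq> sat P"
proof clarify
  fix a b assume ab: "(a, b) \<in> P"
  then have p: "(a, b) \<in> pairs" using P mult_closedD by blast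
  then obtain v where "v \<in> carrier S" "v \<cdot> a \<noteq> z" by (auto simp: pairs_def)
  then show "(a, b) \<in> sat P"
    using mult_closedD(2)[OF P ab] pairs_closed[OF p] by (blast intro: satI)
qed

lemma sat_sat: "sat (sat P) \<subseteq> sat P"
proof clarify
  fix a b assume "(a, b) \<in> sat (sat P)"
  then obtain u v where "a \<in> carrier S" "b \<in> carrier S" "u \<in> carrier S" "v \<in> carrier S"
    "(v \<cdot> (u \<cdot> a), v \<cdot> (u \<cdot> b)) \<in> P" by (auto simp: sat_def)
  then show "(a, b) \<in> sat P" using satI[of a b "v \<cdot> u" P] by (simp add: assoc)
qed

text \<open>If (ua, ub) is in \<open>P\<close> and va \<noteq> 0, then ua and va are nonzero, so pu
  = qv \<noteq> 0 for some p and q. The pair (pua, pub) of \<open>P\<close> is thus the q-multiple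
  of (va, vb).\<close>

lemma mult_closed_sat:
  assumes P: "mult_closed P"
  shows "mult_closed (sat P)"
proof -
  have "(a, b) \<in> pairs" if "(a, b) \<in> sat P" for a b
    using that mult_closedD[OF P] pairs_unmult by (blast elim: satE)
  moreover have "(v \<cdot> a, v \<cdot> b) \<in> sat P"
    if ab: "(a, b) \<in> sat P" and v: "v \<in> carrier S" "v \<cdot> a \<noteq> z" for a b v
  proof -
    obtain u where u: "a \<in> carrier S" "b \<in> carrier S" "u \<in> carrier S" "(u \<cdot> a, u \<cdot> b) \<in> P"
      using ab by (rule satE)
    have ua: "u \<cdot> a \<noteq> z" using u mult_closedD[OF P] pairs_fst_nonzero by blast
    obtain p q where pq: "p \<in> carrier S" "q \<in> carrier S" "p \<cdot> u = q \<cdot> v" "q \<cdot> v \<noteq> z"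
      using common_left_multiple[of u v a] u ua v by blast
    have "p \<cdot> (u \<cdot> a) \<noteq> z" using cat[of p u a] u ua pq by simp
    then have "(p \<cdot> (u \<cdot> a), p \<cdot> (u \<cdot> b)) \<in> P" using mult_closedD(2)[OF P u(4)] pq by blast
    moreover have "p \<cdot> (u \<cdot> a) = q \<cdot> (v \<cdot> a)" "p \<cdot> (u \<cdot> b) = q \<cdot> (v \<cdot> b)"
      using pq u v by (simp_all flip: assoc)
    ultimately show ?thesis using satI[of "v \<cdot> a" "v \<cdot> b" q P] u v pq by simp
  qed
  ultimately show ?thesis by (auto simp: mult_closed_def)
qed

lemma mult_closed_relcomp:
  assumes P: "mult_closed P" and R: "mult_closed R"
  shows "mult_closed (P O R)"
proof -
  have "(a, c) \<in> pairs \<and> (v \<cdot> a \<noteq> z \<longrightarrow> (v \<cdot> a, v \<cdot> c) \<in> P O R)"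
    if "(a, b) \<in> P" "(b, c) \<in> R" "v \<in> carrier S" for a b c v
    using mult_closedD[OF P that(1)] mult_closedD[OF R that(2)] that(3) pairs_trans
      pairs_nonzero[of a b v] by blast
  then show ?thesis unfolding mult_closed_def using zero_closed by blast
qed

lemma mult_closed_converse: "mult_closed P \<Longrightarrow> mult_closed (P\<inverse>)"
  unfolding mult_closed_def using pairs_sym pairs_nonzero_iff by fast

lemma sat_converse: "sat (P\<inverse>) = (sat P)\<inverse>"
  by (auto simp: sat_def)

text \<open>If (ua, ub) is in \<open>P\<close> and (b, c) in \<open>R\<close>, then ub \<noteq> 0,
  so (ub, uc) is in \<open>R\<close> and u can be removed after composing. Absorbing inner
  saturations in this way yields associativity of the product.\<close>

lemma sat_relcomp_left:
  assumes P: "mult_closed P" and R: "mult_closed R"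
  shows "sat (sat P O R) = sat (P O R)"
proof
  have "sat P O R \<subseteq> sat (P O R)"
  proof clarify
    fix a b c assume ab: "(a, b) \<in> sat P" and bc: "(b, c) \<in> R"
    obtain u where u: "a \<in> carrier S" "b \<in> carrier S" "u \<in> carrier S" "(u \<cdot> a, u \<cdot> b) \<in> P"
      using ab by (rule satE)
    have "u \<cdot> b \<noteq> z" using u mult_closedD[OF P] pairs_fst_nonzero pairs_sym by blast
    then have "(u \<cdot> b, u \<cdot> c) \<in> R" using mult_closedD(2)[OF R bc] u by blast
    moreover have "c \<in> carrier S" using mult_closedD[OF R bc] pairs_closed by blast
    ultimately show "(a, c) \<in> sat (P O R)" using u by (blast intro: satI)
  qed
  then show "sat (sat P O R) \<subseteq> sat (P O R)" using sat_mono sat_sat by blast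
  show "sat (P O R) \<subseteq> sat (sat P O R)" using subset_sat[OF P] by (intro sat_mono) blast
qed

lemma sat_relcomp_right:
  assumes P: "mult_closed P" and R: "mult_closed R"
  shows "sat (P O sat R) = sat (P O R)"
  using sat_relcomp_left[OF mult_closed_converse[OF R] mult_closed_converse[OF P]]
  by (simp add: sat_converse flip: converse_relcomp)

lemma directed_sat:
  assumes P: "directed P"
  shows "directed (sat P)"
proof -
  have "\<exists>u\<in>carrier S. \<exists>v\<in>carrier S. u \<cdot> a \<noteq> z \<and> u \<cdot> a = v \<cdot> c \<and> u \<cdot> b = v \<cdot> d"
    if ab: "(a, b) \<in> sat P" and cd: "(c, d) \<in> sat P" for a b c d
  proof -
    obtain u where u: "a \<in> carrier S" "b \<in> carrier S" "u \<in> carrier S" "(u \<cdot> a, u \<cdot> b) \<in> P"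
      using ab by (rule satE)
    obtain v where v: "c \<in> carrier S" "d \<in> carrier S" "v \<in> carrier S" "(v \<cdot> c, v \<cdot> d) \<in> P"
      using cd by (rule satE)
    obtain p q where "p \<in> carrier S" "q \<in> carrier S"
      "p \<cdot> (u \<cdot> a) \<noteq> z" "p \<cdot> (u \<cdot> a) = q \<cdot> (v \<cdot> c)" "p \<cdot> (u \<cdot> b) = q \<cdot> (v \<cdot> d)"
      using directedE[OF P u(4) v(4)] by blast
    then show ?thesis
      using u v by (intro bexI[of _ "p \<cdot> u"] bexI[of _ "q \<cdot> v"]) (simp_all add: assoc)
  qed
  then show ?thesis unfolding directed_def by blast
qed

text \<open>The multipliers (p, q) found in \<open>P\<close> and (s, t) found in \<open>R\<close>
  must be reconciled. As pb and sb are nonzero, there is a common multiple mp = ns; then mqb' =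
  ntb', and cancelling b' gives mq = nt. Hence (mp, mq) serves both factors.\<close>

lemma directed_relcomp:
  assumes P: "mult_closed P" "directed P" and R: "mult_closed R" "directed R"
  shows "directed (P O R)"
proof -
  have "\<exists>u\<in>carrier S. \<exists>v\<in>carrier S. u \<cdot> a \<noteq> z \<and> u \<cdot> a = v \<cdot> a' \<and> u \<cdot> d = v \<cdot> d'"
    if ab: "(a, b) \<in> P" and bd: "(b, d) \<in> R" and ab': "(a', b') \<in> P" and bd': "(b', d') \<in> R"
    for a b d a' b' d'
  proof -
    have c: "a \<in> carrier S" "b \<in> carrier S" "d \<in> carrier S"
      "a' \<in> carrier S" "b' \<in> carrier S" "d' \<in> carrier S"
      using mult_closedD P R that pairs_closed by blast+
    obtain p q where pq: "p \<in> carrier S" "q \<in> carrier S"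
      "p \<cdot> a \<noteq> z" "p \<cdot> a = q \<cdot> a'" "p \<cdot> b = q \<cdot> b'"
      using directedE[OF P(2) ab ab'] .
    obtain s t where st: "s \<in> carrier S" "t \<in> carrier S"
      "s \<cdot> b \<noteq> z" "s \<cdot> b = t \<cdot> b'" "s \<cdot> d = t \<cdot> d'"
      using directedE[OF R(2) bd bd'] .
    have pb: "p \<cdot> b \<noteq> z"
      using pairs_nonzero mult_closedD(1)[OF P(1) ab] pq by blast
    obtain m n where mn: "m \<in> carrier S" "n \<in> carrier S" "m \<cdot> p = n \<cdot> s" "n \<cdot> s \<noteq> z"
      using common_left_multiple[of p s b] pq st pb c by blast
    have 1: "m \<cdot> (p \<cdot> b) = n \<cdot> (s \<cdot> b)" using assoc[of m p b] assoc[of n s b] mn pq st c by simp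
    have 2: "n \<cdot> (s \<cdot> b) \<noteq> z" using cat[of n s b] mn st c by simp
    have mq: "m \<cdot> q = n \<cdot> t"
      using canc_right[of b' "m \<cdot> q" "n \<cdot> t"] 1 2 pq st mn c by (simp add: assoc)
    have "m \<cdot> p \<cdot> a = m \<cdot> (p \<cdot> a)" using mn pq c by (intro assoc)
    then have "m \<cdot> p \<cdot> a \<noteq> z" "m \<cdot> p \<cdot> a = m \<cdot> q \<cdot> a'"
      using cat[of m p a] assoc[of m q a'] mn pq c by auto
    moreover have "m \<cdot> p \<cdot> d = m \<cdot> q \<cdot> d'"
      using st mn c unfolding mn(3) mq by (simp add: assoc)
    ultimately show ?thesis using closed mn(1,2) pq(1,2) by blast
  qed
  then show ?thesis unfolding directed_def by fast
qed

lemma directed_converse: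
  assumes P: "mult_closed P" "directed P"
  shows "directed (P\<inverse>)"
proof -
  have "\<exists>u\<in>carrier S. \<exists>v\<in>carrier S. u \<cdot> b \<noteq> z \<and> u \<cdot> b = v \<cdot> d \<and> u \<cdot> a = v \<cdot> c"
    if ab: "(a, b) \<in> P" and cd: "(c, d) \<in> P" for a b c d
    using directedE[OF P(2) ab cd] pairs_nonzero mult_closedD(1)[OF P(1) ab] by metis
  then show ?thesis unfolding directed_def by fast
qed

lemma fraction_empty: "fraction {}"
  by (simp add: fraction_def mult_closed_def sat_def directed_def)

lemma fraction_sat: "fraction P \<Longrightarrow> sat P = P"
  using subset_sat by (auto simp: fraction_def)

lemma fraction_mult_closed: "fraction P \<Longrightarrow> mult_closed P"
  by (simp add: fraction_def)

lemma fraction_mult: "fraction P \<Longrightarrow> fraction R \<Longrightarrow> fraction (sat (P O R))"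
  using mult_closed_sat mult_closed_relcomp directed_sat directed_relcomp sat_sat
  by (simp add: fraction_def)

lemma fraction_converse: "fraction P \<Longrightarrow> fraction (P\<inverse>)"
  using mult_closed_converse directed_converse sat_converse[of P] by (auto simp: fraction_def)

text \<open>Directedness gives ua = va and ub = vc; cancelling yields first u = v and then b = c.
  Applied also to the converse, this makes every fraction a partial injection.\<close>

lemma fraction_single_valued:
  assumes P: "fraction P" and ab: "(a, b) \<in> P" and ac: "(a, c) \<in> P"
  shows "b = c"
proof -
  have cl: "a \<in> carrier S" "b \<in> carrier S" "c \<in> carrier S" "(a, b) \<in> pairs"
    using fraction_mult_closed[OF P] ab ac mult_closedD pairs_closed by blast+
  obtain u v where uv: "u \<in> carrier S" "v \<in> carrier S"
    "u \<cdot> a \<noteq> z" "u \<cdot> a = v \<cdot> a" "u \<cdot> b = v \<cdot> c"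
    using directedE[OF _ ab ac] P by (auto simp: fraction_def)
  have "v = u" using canc_right[of a v u] uv cl by simp
  moreover have "u \<cdot> b \<noteq> z" using pairs_nonzero cl uv by blast
  ultimately show ?thesis using canc_left[of u b c] uv(1,5) cl by metis
qed

lemma fraction_injective:
  assumes "fraction P" "(a, c) \<in> P" "(b, c) \<in> P"
  shows "a = b"
  using fraction_single_valued[OF fraction_converse[OF assms(1)]] assms by blast

text \<open>Any (c, d) in \<open>P\<close> has a common multiple with (a, b). That multiple lies in
  \<open>R\<close>, and saturation of \<open>R\<close> brings in (c, d) itself.\<close>

lemma fraction_eqI:
  assumes P: "fraction P" and R: "fraction R" and "(a, b) \<in> P" "(a, b) \<in> R"
  shows "P = R"
proof -
  have "P \<subseteq> R" if P: "fraction P" and R: "fraction R" and ab: "(a, b) \<in> P" "(a, b) \<in> R" for P R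
  proof clarify
    fix c d assume cd: "(c, d) \<in> P"
    have cl: "c \<in> carrier S" "d \<in> carrier S"
      using fraction_mult_closed[OF P] cd mult_closedD pairs_closed by blast+
    obtain u v where uv: "u \<in> carrier S" "v \<in> carrier S"
      "u \<cdot> c \<noteq> z" "u \<cdot> c = v \<cdot> a" "u \<cdot> d = v \<cdot> b"
      using directedE[OF _ cd ab(1)] P by (auto simp: fraction_def)
    have "(u \<cdot> c, u \<cdot> d) \<in> R"
      using mult_closedD(2)[OF fraction_mult_closed[OF R] ab(2)] uv by simp
    then show "(c, d) \<in> R" using satI[of c d u R] cl uv R by (auto simp: fraction_def)
  qed
  then show ?thesis using assms by blast
qed

section \<open>The primitive inverse semigroup of fractions\<close>

definition fractions :: "('a \<times> 'a) set sgrp" where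
  "fractions = \<lparr>carrier = Collect fraction, mul = (\<lambda>P R. sat (P O R))\<rparr>"

lemma carrier_fractions [simp]: "P \<in> carrier fractions \<longleftrightarrow> fraction P"
  and mul_fractions [simp]: "P \<cdot>\<^bsub>fractions\<^esub> R = sat (P O R)"
  by (simp_all add: fractions_def)

lemma fraction_mult_left:
  "\<lbrakk>fraction P; fraction R; fraction T\<rbrakk> \<Longrightarrow> sat (sat (P O R) O T) = sat (P O R O T)"
  using sat_relcomp_left[of "P O R" T] by (simp add: mult_closed_relcomp fraction_mult_closed O_assoc)

lemma fraction_mult_right:
  "\<lbrakk>fraction P; fraction R; fraction T\<rbrakk> \<Longrightarrow> sat (P O sat (R O T)) = sat (P O R O T)"
  using sat_relcomp_right[of P "R O T"] by (simp add: mult_closed_relcomp fraction_mult_closed)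

lemma semigrp_fractions: "semigrp fractions"
  by unfold_locales (simp_all add: fraction_mult fraction_mult_left fraction_mult_right)

text \<open>A fraction is a partial injection, so \<open>P O P\<inverse> O P\<close> equals
  \<open>P\<close> even before saturation.\<close>

lemma is_inverse_converse:
  assumes P: "fraction P"
  shows "is_inverse_of fractions P (P\<inverse>)"
proof -
  have comp: "P O P\<inverse> O P = P" if "fraction P" for P
  proof
    show "P O P\<inverse> O P \<subseteq> P" using fraction_injective[OF that] by fast
    show "P \<subseteq> P O P\<inverse> O P" by auto
  qed
  show ?thesis
    using P fraction_converse[OF P] comp[OF P] comp[OF fraction_converse[OF P]]
    by (simp add: is_inverse_of_def fraction_mult_left fraction_sat)
qed

text \<open>For (a, b) in \<open>P\<close> some multiple (ua, ub) factors through \<open>P\<close>,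
  \<open>R\<close> and \<open>P\<close>. It also lies in \<open>P\<close>, so partial injectivity
  forces the middle pair to be (ub, ua), and removing u leaves (b, a) in \<open>R\<close>. Used in
  both directions, this gives uniqueness of inverses.\<close>

lemma converse_subset_inverse:
  assumes P: "fraction P" and R: "fraction R" and eq: "sat (P O R O P) = P"
  shows "P\<inverse> \<subseteq> R"
proof clarify
  fix a b assume ab: "(a, b) \<in> P"
  then have "(a, b) \<in> sat (P O R O P)" by (simp only: eq)
  then obtain u where u: "a \<in> carrier S" "b \<in> carrier S" "u \<in> carrier S"
    and "(u \<cdot> a, u \<cdot> b) \<in> P O R O P"
    by (rule satE)
  then obtain s t where st: "(u \<cdot> a, s) \<in> P" "(s, t) \<in> R" "(t, u \<cdot> b) \<in> P"
    by blast
  have "u \<cdot> a \<noteq> z"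
    using st(1) fraction_mult_closed[OF P] mult_closedD pairs_fst_nonzero by blast
  then have "(u \<cdot> a, u \<cdot> b) \<in> P"
    using mult_closedD(2)[OF fraction_mult_closed[OF P] ab] u by blast
  then have "s = u \<cdot> b" "t = u \<cdot> a"
    using st fraction_single_valued[OF P] fraction_injective[OF P] by blast+
  then show "(b, a) \<in> R" using st(2) satI[of b a u R] u R by (auto simp: fraction_def)
qed

lemma inverse_semigrp_fractions: "inverse_semigrp fractions"
proof (intro inverse_semigrp.intro inverse_semigrp_axioms.intro semigrp_fractions)
  fix P assume "P \<in> carrier fractions"
  then have P: "fraction P" by simp
  show "\<exists>!R. is_inverse_of fractions P R"
  proof (intro ex1I)
    show "is_inverse_of fractions P (P\<inverse>)" by (rule is_inverse_converse[OF P])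
    fix R assume inv: "is_inverse_of fractions P R"
    then have R: "fraction R" and eq: "sat (P O R O P) = P" "sat (R O P O R) = R"
      using P by (auto simp: is_inverse_of_def fraction_mult_left)
    show "R = P\<inverse>"
      using converse_subset_inverse[OF P R eq(1)] converse_subset_inverse[OF R P eq(2)]
      by (simp add: converse_subset_swap subset_antisym)
  qed
qed

lemma inverse_in_fractions: "fraction P \<Longrightarrow> inverse_in fractions P = P\<inverse>"
  using inverse_semigrp.inverse_unique[OF inverse_semigrp_fractions _ _ is_inverse_converse]
    inverse_semigrp.is_inverse_iv[OF inverse_semigrp_fractions] by simp

text \<open>Some multiple (ua, ub) factors as (ua, t), (t, ub) inside \<open>P\<close>.
  Single-valuedness gives t = ub; then injectivity on (ua, ub) and (ub, ub) gives ua = ub, and u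
  cancels.\<close>

lemma idempotent_fraction_subset_Id:
  assumes P: "P \<in> idempotents fractions"
  shows "P \<subseteq> Id"
proof clarify
  fix a b assume ab: "(a, b) \<in> P"
  have fr: "fraction P" and eq: "sat (P O P) = P" using P by (auto simp: idempotents_def)
  from ab have "(a, b) \<in> sat (P O P)" by (simp only: eq)
  then obtain u where u: "a \<in> carrier S" "b \<in> carrier S" "u \<in> carrier S"
    and "(u \<cdot> a, u \<cdot> b) \<in> P O P"
    by (rule satE)
  then obtain t where t: "(u \<cdot> a, t) \<in> P" "(t, u \<cdot> b) \<in> P"
    by blast
  have ua: "u \<cdot> a \<noteq> z"
    using t(1) fraction_mult_closed[OF fr] mult_closedD pairs_fst_nonzero by blast
  then have uab: "(u \<cdot> a, u \<cdot> b) \<in> P"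
    using mult_closedD(2)[OF fraction_mult_closed[OF fr] ab] u by blast
  then have "t = u \<cdot> b" using t fraction_single_valued[OF fr] by blast
  then have "u \<cdot> a = u \<cdot> b" using t uab fraction_injective[OF fr] by blast
  then show "a = b" using canc_left[of u b a] ua u by simp
qed

lemma primitive_fractions: "primitive_inverse_semigrp fractions"
proof -
  have "is_zero fractions {}" by (simp add: is_zero_def fraction_empty sat_def)
  moreover have "R = {} \<or> R = P"
    if P: "P \<in> idempotents fractions" and R: "R \<in> idempotents fractions"
      and eq: "P \<cdot>\<^bsub>fractions\<^esub> R = R" for P R
  proof (cases "R = {}")
    case False
    then have "sat (P O R) \<noteq> {}" using eq by simp
    then have "P O R \<noteq> {}" by (auto simp: sat_def)
    \<comment> \<open>As both relations are diagonal, a pair of the composite is a common member of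
      \<open>P\<close> and \<open>R\<close>, and fractions that meet are equal.\<close>
    then obtain a b c where "(a, b) \<in> P" "(b, c) \<in> R" by auto
    moreover from this have "a = b" "b = c"
      using idempotent_fraction_subset_Id P R by blast+
    ultimately show ?thesis
      using fraction_eqI[of R P] P R by (auto simp: idempotents_def)
  qed simp
  ultimately show ?thesis
    unfolding primitive_inverse_semigrp_def using inverse_semigrp_fractions by blast
qed

section \<open>Embedding \<open>S\<close> by right translations\<close>

definition translation :: "'a \<Rightarrow> ('a \<times> 'a) set" where
  "translation a = {(x, x \<cdot> a) | x. x \<in> carrier S \<and> x \<cdot> a \<noteq> z}"

text \<open>Left cancellation gives saturation. Directedness holds because xa and ya are nonzero,
  which provides a common left multiple of x and y.\<close>

lemma fraction_translation:
  assumes a: "a \<in> carrier S"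
  shows "fraction (translation a)"
proof -
  have "(x, x \<cdot> a) \<in> pairs" if x: "x \<in> carrier S" "x \<cdot> a \<noteq> z" for x
  proof -
    obtain v where v: "v \<in> carrier S" "v \<cdot> (x \<cdot> a) \<noteq> z"
      using left_nonzero[of "x \<cdot> a"] x a by auto
    then have "v \<cdot> x \<noteq> z" using x a by (metis assoc zero_mult(1))
    then show ?thesis using v x a by (auto simp: pairs_def)
  qed
  then have "mult_closed (translation a)"
    using a cat by (auto simp: mult_closed_def translation_def assoc)
  moreover have "sat (translation a) \<subseteq> translation a"
  proof clarify
    fix x y assume "(x, y) \<in> sat (translation a)"
    then obtain u where u: "x \<in> carrier S" "y \<in> carrier S" "u \<in> carrier S"
      "u \<cdot> y = u \<cdot> (x \<cdot> a)" "u \<cdot> (x \<cdot> a) \<noteq> z"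
      using a by (auto simp: translation_def assoc elim!: satE)
    then have "y = x \<cdot> a" using canc_left[of u y "x \<cdot> a"] a by simp
    moreover have "x \<cdot> a \<noteq> z" using u(3,5) by (metis zero_mult(2))
    ultimately show "(x, y) \<in> translation a" using u by (auto simp: translation_def)
  qed
  moreover have "\<exists>u\<in>carrier S. \<exists>v\<in>carrier S.
      u \<cdot> x \<noteq> z \<and> u \<cdot> x = v \<cdot> y \<and> u \<cdot> (x \<cdot> a) = v \<cdot> (y \<cdot> a)"
    if xy: "x \<in> carrier S" "x \<cdot> a \<noteq> z" "y \<in> carrier S" "y \<cdot> a \<noteq> z" for x y
  proof -
    obtain u v where "u \<in> carrier S" "v \<in> carrier S" "u \<cdot> x = v \<cdot> y" "v \<cdot> y \<noteq> z"
      using common_left_multiple[of x y a] xy a by blast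
    then show ?thesis using xy a
      by (intro bexI[of _ u] bexI[of _ v]) (simp_all flip: assoc)
  qed
  then have "directed (translation a)" by (auto simp: directed_def translation_def)
  ultimately show ?thesis by (simp add: fraction_def)
qed

text \<open>Since xab \<noteq> 0 implies xa \<noteq> 0, the composite is already a translation, and
  saturation does not change it.\<close>

lemma translation_mult:
  assumes a: "a \<in> carrier S" and b: "b \<in> carrier S"
  shows "translation (a \<cdot> b) = sat (translation a O translation b)"
proof -
  have "x \<cdot> a \<noteq> z" if "x \<in> carrier S" "x \<cdot> (a \<cdot> b) \<noteq> z" for x
    using that a b by (metis assoc zero_mult(1))
  then have "translation (a \<cdot> b) = translation a O translation b"
    using a b by (fastforce simp: translation_def assoc)
  then show ?thesis using fraction_sat[OF fraction_translation[of "a \<cdot> b"]] a b by simp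
qed

lemma inj_translation: "inj_on translation (carrier S)"
proof (rule inj_onI)
  have *: "a = b"
    if c: "a \<in> carrier S" "b \<in> carrier S" and eq: "translation a = translation b" and "a \<noteq> z"
    for a b
  proof -
    obtain x where "x \<in> carrier S" "x \<cdot> a \<noteq> z" using left_nonzero c \<open>a \<noteq> z\<close> by blast
    then have "(x, x \<cdot> a) \<in> translation a" by (auto simp: translation_def)
    then have "(x, x \<cdot> a) \<in> translation b" by (simp only: eq)
    then have "x \<cdot> a = x \<cdot> b" "x \<cdot> b \<noteq> z" by (auto simp: translation_def)
    then show ?thesis using canc_left \<open>x \<in> carrier S\<close> c by blast
  qed
  fix a b assume "a \<in> carrier S" "b \<in> carrier S" "translation a = translation b"
  \<comment> \<open>The fact \<open>*\<close> requires a nonzero first element; for a =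
    \<open>z\<close> its swapped instance covers b \<noteq> \<open>z\<close>.\<close>
  then show "a = b" using *[of a b] *[of b a] by (cases "a = z") auto
qed

lemma left_I_order_translation: "left_I_order (translation ` carrier S) fractions"
proof -
  have "\<exists>a\<in>carrier S. \<exists>b\<in>carrier S. P = sat ((translation a)\<inverse> O translation b)"
    if P: "fraction P" for P
  proof (cases "P = {}")
    case True
    have "translation z = {}" by (auto simp: translation_def)
    then show ?thesis using True by (intro bexI[of _ z]) (simp_all add: sat_def)
  next
    case False
    then obtain a b where ab: "(a, b) \<in> P" by auto
    then have "(a, b) \<in> pairs" using mult_closedD fraction_mult_closed[OF P] by blast
    then obtain x where x: "a \<in> carrier S" "b \<in> carrier S" "x \<in> carrier S" "x \<cdot> a \<noteq> z" "x \<cdot> b \<noteq> z"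
      by (auto simp: pairs_def)
    \<comment> \<open>The multiple of (a, b) by x lies in the composite with x as middle element;
      saturation then removes x.\<close>
    then have "(x \<cdot> a, x \<cdot> b) \<in> (translation a)\<inverse> O translation b"
      by (auto simp: translation_def)
    then have "(a, b) \<in> sat ((translation a)\<inverse> O translation b)" using x by (blast intro: satI)
    moreover have "fraction (sat ((translation a)\<inverse> O translation b))"
      using x by (intro fraction_mult fraction_converse fraction_translation)
    ultimately show ?thesis using fraction_eqI[OF P _ ab] x by blast
  qed
  then show ?thesis
    by (auto simp: left_I_order_def fraction_translation inverse_in_fractions
        translation_mult[symmetric])
qed

lemma is_left_I_order_in_fractions: "is_left_I_order_in S fractions"
  unfolding is_left_I_order_in_def semigrp_embedding_def
  using left_I_order_translation inj_translation fraction_translation translation_mult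
  by (intro exI[of _ translation]) simp

end

section \<open>The conditions in rule form, and the equivalence\<close>

lemma (in semigrp) left_fractions_iff_conditions:
  "(\<exists>z. left_fractions S z) \<longleftrightarrow> conditions_A_to_D S"
proof -
  have cat: "categorical_at_zero S z \<longleftrightarrow>
      (\<forall>a b c. a \<in> carrier S \<longrightarrow> b \<in> carrier S \<longrightarrow> c \<in> carrier S \<longrightarrow>
        a \<cdot> b \<noteq> z \<longrightarrow> b \<cdot> c \<noteq> z \<longrightarrow> a \<cdot> (b \<cdot> c) \<noteq> z)" for z
    by (auto simp: categorical_at_zero_def assoc)
  have canc: "zero_cancellative S z \<longleftrightarrow>
      (\<forall>a b c. a \<in> carrier S \<longrightarrow> b \<in> carrier S \<longrightarrow> c \<in> carrier S \<longrightarrow>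
        a \<cdot> b = a \<cdot> c \<longrightarrow> a \<cdot> c \<noteq> z \<longrightarrow> b = c) \<and>
      (\<forall>a b c. a \<in> carrier S \<longrightarrow> b \<in> carrier S \<longrightarrow> c \<in> carrier S \<longrightarrow>
        b \<cdot> a = c \<cdot> a \<longrightarrow> c \<cdot> a \<noteq> z \<longrightarrow> b = c)" for z
    unfolding zero_cancellative_def by blast
  have left: "(\<forall>a\<in>carrier S. a \<noteq> z \<longrightarrow> left_multiples S a \<noteq> {z}) \<longleftrightarrow>
      (\<forall>a. a \<in> carrier S \<longrightarrow> a \<noteq> z \<longrightarrow> (\<exists>x\<in>carrier S. x \<cdot> a \<noteq> z))" if "is_zero S z" for z
    using left_multiples_nonzero_iff[OF that] by blast
  have "left_fractions S z \<longleftrightarrow> is_zero S z \<and> categorical_at_zero S z \<and> zero_cancellative S z \<and>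
      transp_on (carrier S) (lambda_rel S z) \<and>
      (\<forall>a\<in>carrier S. a \<noteq> z \<longrightarrow> left_multiples S a \<noteq> {z})" for z
    unfolding left_fractions_def left_fractions_axioms_def cat canc
    using semigrp_axioms left[of z] by argo
  then show ?thesis by (simp add: conditions_A_to_D_def)
qed

theorem theorem3p1:
  fixes S :: "'a sgrp"
  assumes "semigrp S"
  shows "((\<exists>Q :: ('a \<times> 'a) set sgrp. primitive_inverse_semigrp Q \<and> is_left_I_order_in S Q)
            \<longleftrightarrow> conditions_A_to_D S)
       \<and> (\<forall>Q :: 'b sgrp. primitive_inverse_semigrp Q \<and> is_left_I_order_in S Q
            \<longrightarrow> conditions_A_to_D S)"
proof -
  have "\<exists>Q :: ('a \<times> 'a) set sgrp. primitive_inverse_semigrp Q \<and> is_left_I_order_in S Q"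
    if AD: "conditions_A_to_D S"
  proof -
    obtain z where z: "left_fractions S z"
      using semigrp.left_fractions_iff_conditions[OF assms] AD by blast
    show ?thesis
      using left_fractions.primitive_fractions[OF z]
        left_fractions.is_left_I_order_in_fractions[OF z] by blast
  qed
  then show ?thesis by (auto intro: conditions_if_left_I_order[OF assms])
qed

end
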